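(* Let $\lambda>0$, $\chi>0$, $T>0$, and let $\Omega\subset\mathbb{R}^n$ be a bounded $C^2$ domain such that $B_R\subset\Omega$ for some constant $R>0$, where $B_R=\{x\in\mathbb{R}^n:|x|<R\}$. Let $0\le u_0\le a$ in $\Omega$ for some constant $0<a<1$, and let $0\le u<1$ be a solution in $\Omega\times(0,T)$ of the problem $$\frac{\partial u}{\partial t}=\Delta u+\frac{\lambda}{(1-u)^2\bigl(1+\chi\int_\Omega\frac{dy}{1-u(y,t)}\bigr)^2}\ \text{ in }\Omega\times(0,T),\qquad u=0\ \text{ on }\partial\Omega\times(0,T),\qquad u(x,0)=u_0\ \text{ in }\Omega,$$ such that $$\sup_{0\le t<T}\int_{\Omega}\frac{dz}{1-u(z,t)}<\infty .$$ Let $$A(t)=\Bigl(1+\chi\int_{\Omega}\frac{dz}{1-u(z,t)}\Bigr)^{-2}$$ and let $\delta_1$ be a constant with $0<\delta_1\le\inf_{0\le t<T}A(t)$. Suppose $\lambda>\dfrac{2n}{\delta_1R^2}$. Then $$T\le\frac{1}{\lambda\delta_1}\Bigl(1-\frac{2n}{\lambda\delta_1R^2}\Bigr)^{-1}.$$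
   Context: Notion of solution. For $u_0\in L^1(\Omega)$ with $u_0\le a$ a.e. in $\Omega$ for some constant $0<a<1$, a function $u$ is a solution of the problem in $\Omega\times(0,T)$ if $u\in C^{2,1}(\Omega\times(0,T))\cap C(\overline{\Omega}\times(0,T))$, $u<1$, $u$ satisfies the partial differential equation in the classical sense in $\Omega\times(0,T)$, $u(x,t)=0$ on $\partial\Omega\times(0,T)$, $\sup_{\overline{\Omega}\times[0,T']}u<1$ for every $0<T'<T$, and $\|u(\cdot,t)-u_0\|_{L^1(\Omega)}\to0$ as $t\to0$. At $t=0$ one sets $u(\cdot,0)=u_0$. *)

theory Defs
  imports "HOL-Analysis.Analysis"
begin

definition partially_differentiable :: "'n \<Rightarrow> (real^'n \<Rightarrow> real) \<Rightarrow> real^'n \<Rightarrow> bool" where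
  "partially_differentiable i f x \<longleftrightarrow> (\<lambda>h. f (x + h *\<^sub>R axis i 1)) field_differentiable (at 0)"

definition partial_deriv :: "'n \<Rightarrow> (real^'n \<Rightarrow> real) \<Rightarrow> real^'n \<Rightarrow> real" where
  "partial_deriv i f x = deriv (\<lambda>h. f (x + h *\<^sub>R axis i 1)) 0"

definition laplacian :: "(real^'n::finite \<Rightarrow> real) \<Rightarrow> real^'n \<Rightarrow> real" where
  "laplacian f x = (\<Sum>i\<in>UNIV. partial_deriv i (partial_deriv i f) x)"

text \<open>\<open>C2_on\<close> and \<open>C21_on\<close> are meant for open sets.\<close>

definition C2_on :: "(real^'n) set \<Rightarrow> (real^'n::finite \<Rightarrow> real) \<Rightarrow> bool" where
  "C2_on S f \<longleftrightarrow>
     continuous_on S f \<and>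
     (\<forall>i. (\<forall>x\<in>S. partially_differentiable i f x) \<and> continuous_on S (partial_deriv i f)) \<and>
     (\<forall>i j. (\<forall>x\<in>S. partially_differentiable j (partial_deriv i f) x) \<and>
            continuous_on S (partial_deriv j (partial_deriv i f)))"

text \<open>The class $C^{2,1}$: all space derivatives up to order two and the first time derivative
  exist and are jointly continuous.\<close>

definition C21_on :: "(real^'n) set \<Rightarrow> real set \<Rightarrow> (real^'n::finite \<Rightarrow> real \<Rightarrow> real) \<Rightarrow> bool" where
  "C21_on S J u \<longleftrightarrow>
     continuous_on (S \<times> J) (\<lambda>(x, t). u x t) \<and>
     (\<forall>x\<in>S. \<forall>t\<in>J. (\<lambda>s. u x s) field_differentiable (at t)) \<and>
     continuous_on (S \<times> J) (\<lambda>(x, t). deriv (\<lambda>s. u x s) t) \<and>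
     (\<forall>i. (\<forall>x\<in>S. \<forall>t\<in>J. partially_differentiable i (\<lambda>y. u y t) x) \<and>
          continuous_on (S \<times> J) (\<lambda>(x, t). partial_deriv i (\<lambda>y. u y t) x)) \<and>
     (\<forall>i j. (\<forall>x\<in>S. \<forall>t\<in>J. partially_differentiable j (partial_deriv i (\<lambda>y. u y t)) x) \<and>
            continuous_on (S \<times> J) (\<lambda>(x, t). partial_deriv j (partial_deriv i (\<lambda>y. u y t)) x))"

text \<open>Near each boundary point, up to relabelling and reflecting the coordinate axes, the domain
  is the region above the graph of a $C^2$ function of the other coordinates. Such a function of
  $n-1$ variables is represented by a function \<open>\<gamma>\<close> on the whole space that does not depend on the
  coordinate \<open>k\<close>.\<close>

definition bounded_C2_domain :: "(real^'n::finite) set \<Rightarrow> bool" where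
  "bounded_C2_domain \<Omega> \<longleftrightarrow>
     open \<Omega> \<and> connected \<Omega> \<and> \<Omega> \<noteq> {} \<and> bounded \<Omega> \<and>
     (\<forall>p\<in>frontier \<Omega>. \<exists>r>0. \<exists>k. \<exists>s\<in>{-1, 1::real}. \<exists>\<gamma>.
        C2_on UNIV \<gamma> \<and>
        (\<forall>x y. (\<forall>j. j \<noteq> k \<longrightarrow> x $ j = y $ j) \<longrightarrow> \<gamma> x = \<gamma> y) \<and>
        \<Omega> \<inter> ball p r = {x \<in> ball p r. s * x $ k > \<gamma> x})"

definition nonlocal_A :: "real \<Rightarrow> (real^'n::finite) set \<Rightarrow> (real^'n \<Rightarrow> real \<Rightarrow> real) \<Rightarrow> real \<Rightarrow> real" where
  "nonlocal_A chi \<Omega> u t = 1 / (1 + chi * (LINT z:\<Omega>|lebesgue. 1 / (1 - u z t)))\<^sup>2"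

text \<open>The condition $\sup_{\overline\Omega \times [0,T']} u < 1$ is stated with an upper bound
  \<open>c < 1\<close>. Its part at time \<open>0\<close>, where \<open>u\<close> is the \<open>L\<^sup>1\<close> function \<open>u\<^sub>0\<close>, is an essential bound; the
  boundary of the domain has measure zero, so only points of the domain matter there.\<close>

definition is_solution ::
  "real \<Rightarrow> real \<Rightarrow> (real^'n::finite) set \<Rightarrow> real \<Rightarrow> (real^'n \<Rightarrow> real) \<Rightarrow> (real^'n \<Rightarrow> real \<Rightarrow> real) \<Rightarrow> bool"
where
  "is_solution lam chi \<Omega> T u\<^sub>0 u \<longleftrightarrow>
     C21_on \<Omega> {0<..<T} u \<and>
     continuous_on (closure \<Omega> \<times> {0<..<T}) (\<lambda>(x, t). u x t) \<and>
     (\<forall>x\<in>\<Omega>. \<forall>t\<in>{0<..<T}. u x t < 1) \<and>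
     (\<forall>x\<in>\<Omega>. \<forall>t\<in>{0<..<T}.
        deriv (\<lambda>s. u x s) t =
          laplacian (\<lambda>y. u y t) x +
          lam / ((1 - u x t)\<^sup>2 * (1 + chi * (LINT y:\<Omega>|lebesgue. 1 / (1 - u y t)))\<^sup>2)) \<and>
     (\<forall>x\<in>frontier \<Omega>. \<forall>t\<in>{0<..<T}. u x t = 0) \<and>
     (\<forall>T'\<in>{0<..<T}. \<exists>c<1.
        (\<forall>x\<in>closure \<Omega>. \<forall>t\<in>{0<..T'}. u x t \<le> c) \<and>
        (AE x in lebesgue. x \<in> \<Omega> \<longrightarrow> u x 0 \<le> c)) \<and>
     (\<forall>x\<in>\<Omega>. u x 0 = u\<^sub>0 x) \<and>
     ((\<lambda>t. LINT x:\<Omega>|lebesgue. \<bar>u x t - u\<^sub>0 x\<bar>) \<longlongrightarrow> 0) (at_right 0)"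

end

theory Submission
  imports Defs
begin

text \<open>Since \<open>A \<ge> \<delta>\<^sub>1\<close> and \<open>0 \<le> u < 1\<close>, the solution satisfies \<open>u\<^sub>t \<ge> \<Delta>u + \<lambda>\<delta>\<^sub>1\<close>. On the cylinder over
  \<open>B\<^sub>R\<close> starting at a time \<open>\<epsilon> > 0\<close> it is compared with \<open>c (t - \<epsilon>) (1 - |x|\<^sup>2 / R\<^sup>2)\<close>, which is a strict
  subsolution of this inequality up to time \<open>\<epsilon> + 1 / c\<close> whenever \<open>c < \<lambda>\<delta>\<^sub>1 - 2n / R\<^sup>2\<close>. As \<open>u (0, \<epsilon> + 1 / c)\<close>
  would then be at least \<open>1\<close>, necessarily \<open>T \<le> \<epsilon> + 1 / c\<close>.\<close>

text \<open>At the minimum \<open>g' 0 = 0\<close>, so \<open>D < 0\<close> would make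
  \<open>g'\<close> negative just to the right of 0, and the mean value theorem would push
  \<open>g\<close> below \<open>g 0\<close>.\<close>

lemma second_derivative_nonneg_at_local_min:
  fixes g g' :: "real \<Rightarrow> real"
  assumes "d > 0"
    and min: "\<And>h. \<bar>h\<bar> < d \<Longrightarrow> g 0 \<le> g h"
    and deriv1: "\<And>h. \<bar>h\<bar> < d \<Longrightarrow> (g has_real_derivative g' h) (at h)"
    and deriv2: "(g' has_real_derivative D) (at 0)"
  shows "D \<ge> 0"
proof (rule ccontr)
  assume "\<not> D \<ge> 0"
  then obtain e where e: "e > 0" "\<And>h. 0 < h \<Longrightarrow> h < e \<Longrightarrow> g' h < g' 0"
    using DERIV_neg_dec_right[OF deriv2] by auto
  have "g' 0 = 0"
    using DERIV_local_min[OF deriv1[of 0] \<open>d > 0\<close>] min \<open>d > 0\<close> by simp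
  define h where "h = min d e / 2"
  have h: "0 < h" "h < d" "h < e"
    using \<open>d > 0\<close> e(1) by (auto simp: h_def)
  obtain z where z: "0 < z" "z < h" "g h - g 0 = (h - 0) * g' z"
    using MVT2[of 0 h g g'] h deriv1 by (auto simp: abs_if)
  have "g' z < 0"
    using e(2)[of z] z h \<open>g' 0 = 0\<close> by simp
  then have "g h < g 0"
    using z h mult_pos_neg[of h "g' z"] by simp
  then show False
    using min[of h] h by simp
qed

text \<open>\<open>partial_deriv\<close> is a derivative at parameter 0; translating the parameter
  turns it into a derivative at every point of the coordinate line, as one-variable arguments
  require.\<close>

lemma partial_deriv_along_axis:
  assumes "partially_differentiable i f (x + h *\<^sub>R axis i 1)"
  shows "((\<lambda>s. f (x + s *\<^sub>R axis i 1)) has_real_derivative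
           partial_deriv i f (x + h *\<^sub>R axis i 1)) (at h)"
proof -
  have "((\<lambda>s. f (x + h *\<^sub>R axis i 1 + s *\<^sub>R axis i 1)) has_real_derivative
           partial_deriv i f (x + h *\<^sub>R axis i 1)) (at 0)"
    using assms unfolding partially_differentiable_def partial_deriv_def
    by (simp add: DERIV_deriv_iff_field_differentiable)
  then have "((\<lambda>s. f (x + (s + h) *\<^sub>R axis i 1)) has_real_derivative
           partial_deriv i f (x + h *\<^sub>R axis i 1)) (at 0)"
    by (simp add: algebra_simps)
  then show ?thesis
    using DERIV_shift[of "\<lambda>s. f (x + s *\<^sub>R axis i 1)" _ 0 h] by simp
qed

text \<open>The second derivative test applies along each axis to \<open>f\<close> plus the
  paraboloid, whose pure second derivatives exceed those of \<open>f\<close> by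
  \<open>2 * k\<close>; summing over the axes gives the bound.\<close>

lemma laplacian_ge_at_paraboloid_contact:
  fixes f :: "real^'n::finite \<Rightarrow> real"
  assumes "d > 0"
    and diff1: "\<And>i y. y \<in> ball x d \<Longrightarrow> partially_differentiable i f y"
    and diff2: "\<And>i. partially_differentiable i (partial_deriv i f) x"
    and min: "\<And>y. y \<in> ball x d \<Longrightarrow> f x + k * (norm x)\<^sup>2 \<le> f y + k * (norm y)\<^sup>2"
  shows "laplacian f x \<ge> - 2 * k * real CARD('n)"
proof -
  have "partial_deriv i (partial_deriv i f) x \<ge> - 2 * k" for i
  proof -
    define e :: "real^'n" where "e = axis i 1"
    have ball: "x + h *\<^sub>R e \<in> ball x d" if "\<bar>h\<bar> < d" for h
      using that by (simp add: dist_norm e_def)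
    have norm: "(norm (x + h *\<^sub>R e))\<^sup>2 = (norm x)\<^sup>2 + 2 * h * (x $ i) + h\<^sup>2" for h
      unfolding power2_norm_eq_inner
      by (simp add: e_def inner_add_left inner_add_right inner_axis inner_commute
          power2_eq_square algebra_simps)
    \<comment> \<open>The restriction to the axis, with the constant
      \<open>k * (norm x)\<^sup>2\<close> dropped.\<close>
    let ?g = "\<lambda>h. f (x + h *\<^sub>R e) + k * (2 * h * (x $ i) + h\<^sup>2)"
    let ?g' = "\<lambda>h. partial_deriv i f (x + h *\<^sub>R e) + k * (2 * (x $ i) + 2 * h)"
    have "0 \<le> partial_deriv i (partial_deriv i f) x + 2 * k"
    proof (rule second_derivative_nonneg_at_local_min[OF \<open>d > 0\<close>, of ?g ?g'])
      show "?g 0 \<le> ?g h" if "\<bar>h\<bar> < d" for h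
        using min[OF ball[OF that]] by (simp add: norm algebra_simps)
      show "(?g has_real_derivative ?g' h) (at h)" if "\<bar>h\<bar> < d" for h
        using partial_deriv_along_axis[of i f x h] diff1[OF ball[OF that]]
        by (auto simp: e_def intro!: derivative_eq_intros)
      have "((\<lambda>h. partial_deriv i f (x + h *\<^sub>R e)) has_real_derivative
               partial_deriv i (partial_deriv i f) x) (at 0)"
        using partial_deriv_along_axis[of i "partial_deriv i f" x 0] diff2 by (simp add: e_def)
      then show "(?g' has_real_derivative partial_deriv i (partial_deriv i f) x + 2 * k) (at 0)"
        by (auto intro!: derivative_eq_intros)
    qed
    then show ?thesis by simp
  qed
  then have "(\<Sum>i\<in>(UNIV::'n set). - 2 * k) \<le> laplacian f x"
    unfolding laplacian_def by (intro sum_mono) auto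
  then show ?thesis by (simp add: mult.commute)
qed

text \<open>Only earlier times are compared, so that this also covers a minimum attained at the
  final time of a cylinder.\<close>

lemma deriv_nonpos_at_left_min:
  fixes f :: "real \<Rightarrow> real"
  assumes "(f has_real_derivative D) (at t)" "s < t" "\<And>r. s \<le> r \<Longrightarrow> r \<le> t \<Longrightarrow> f t \<le> f r"
  shows "D \<le> 0"
proof (rule ccontr)
  assume "\<not> D \<le> 0"
  then obtain d where d: "d > 0" "\<And>h. 0 < h \<Longrightarrow> h < d \<Longrightarrow> f (t - h) < f t"
    using DERIV_pos_inc_left[OF assms(1)] by auto
  define h where "h = min (d / 2) (t - s)"
  have "0 < h" "h < d" "s \<le> t - h"
    using d(1) \<open>s < t\<close> by (auto simp: h_def)
  then show False
    using d(2)[of h] assms(3)[of "t - h"] by simp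
qed

lemma supersolution_ge_paraboloid:
  fixes u :: "real^'n::finite \<Rightarrow> real \<Rightarrow> real"
  assumes "R > 0" "c > 0" "t1 \<ge> t0"
    and cont: "continuous_on (cball 0 R \<times> {t0..t1}) (\<lambda>(x, t). u x t)"
    and nonneg: "\<And>x t. x \<in> cball 0 R \<Longrightarrow> t \<in> {t0..t1} \<Longrightarrow> u x t \<ge> 0"
    and diff_t: "\<And>x t. x \<in> ball 0 R \<Longrightarrow> t \<in> {t0..t1} \<Longrightarrow> (\<lambda>s. u x s) field_differentiable (at t)"
    and diff1: "\<And>i x t. x \<in> ball 0 R \<Longrightarrow> t \<in> {t0..t1} \<Longrightarrow>
        partially_differentiable i (\<lambda>y. u y t) x"
    and diff2: "\<And>i x t. x \<in> ball 0 R \<Longrightarrow> t \<in> {t0..t1} \<Longrightarrow>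
        partially_differentiable i (partial_deriv i (\<lambda>y. u y t)) x"
    and super: "\<And>x t. x \<in> ball 0 R \<Longrightarrow> t \<in> {t0..t1} \<Longrightarrow>
        deriv (\<lambda>s. u x s) t > laplacian (\<lambda>y. u y t) x + c + 2 * real CARD('n) * c * (t - t0) / R\<^sup>2"
    and "x \<in> cball 0 R" "t \<in> {t0..t1}"
  shows "u x t \<ge> c * (t - t0) * (1 - (norm x)\<^sup>2 / R\<^sup>2)"
proof -
  define v where "v = (\<lambda>(x, t). u x t - c * (t - t0) * (1 - (norm x)\<^sup>2 / R\<^sup>2))"
  have "continuous_on (cball 0 R \<times> {t0..t1}) v"
    unfolding v_def case_prod_beta
    by (intro continuous_intros cont[unfolded case_prod_beta]) (use \<open>R > 0\<close> in auto)
  moreover have "compact (cball (0::real^'n) R \<times> {t0..t1})"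
    by (intro compact_Times) auto
  moreover have "(cball (0::real^'n) R \<times> {t0..t1}) \<noteq> {}"
    using assms by auto
  ultimately obtain p where p: "p \<in> cball 0 R \<times> {t0..t1}"
      "\<forall>q\<in>cball 0 R \<times> {t0..t1}. v p \<le> v q"
    using continuous_attains_inf by metis
  obtain x0 s where ps: "p = (x0, s)" by (cases p)
  have x0: "norm x0 \<le> R" and s: "t0 \<le> s" "s \<le> t1"
    using p ps by auto
  have vmin: "v (x0, s) \<le> v (y, r)" if "norm y \<le> R" "t0 \<le> r" "r \<le> t1" for y r
    using p(2) that ps by auto
  have "v (x0, s) \<ge> 0"
  \<comment> \<open>On the lateral boundary and at the initial time the barrier vanishes, so
    \<open>v\<close> equals \<open>u\<close> there. The other case includes
    \<open>s = t1\<close>.\<close>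
  proof (cases "norm x0 = R \<or> s = t0")
    case True
    then show ?thesis
      using nonneg[of x0 s] x0 s \<open>R > 0\<close> by (auto simp: v_def)
  next
    case False
    then have x0': "norm x0 < R" and s': "t0 < s"
      using x0 s by auto
    define d where "d = R - norm x0"
    have "d > 0" using x0' by (simp add: d_def)
    have sub: "norm y < R" if "y \<in> ball x0 d" for y
      using that norm_triangle_ineq2[of y x0] by (simp add: d_def dist_norm norm_minus_commute)
    \<comment> \<open>With this \<open>k\<close>, \<open>u y s + k * (norm y)\<^sup>2\<close>
      differs from \<open>v (y, s)\<close> only by \<open>c * (s - t0)\<close>, which is constant in
      \<open>y\<close>.\<close>
    define k where "k = c * (s - t0) / R\<^sup>2"
    have lap: "laplacian (\<lambda>y. u y s) x0 \<ge> - 2 * k * real CARD('n)"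
    proof (rule laplacian_ge_at_paraboloid_contact[OF \<open>d > 0\<close>])
      show "partially_differentiable i (\<lambda>y. u y s) y" if "y \<in> ball x0 d" for i y
        using diff1 sub[OF that] s by auto
      show "partially_differentiable i (partial_deriv i (\<lambda>y. u y s)) x0" for i
        using diff2 x0' s by auto
      show "u x0 s + k * (norm x0)\<^sup>2 \<le> u y s + k * (norm y)\<^sup>2" if "y \<in> ball x0 d" for y
        using vmin[of y s] sub[OF that] s by (simp add: v_def k_def algebra_simps)
    qed
    let ?w = "1 - (norm x0)\<^sup>2 / R\<^sup>2"
    have "((\<lambda>r. u x0 r) has_real_derivative deriv (\<lambda>r. u x0 r) s) (at s)"
      using diff_t[of x0 s] x0' s by (simp add: DERIV_deriv_iff_field_differentiable)
    then have "((\<lambda>r. v (x0, r)) has_real_derivative deriv (\<lambda>r. u x0 r) s - c * ?w) (at s)"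
      unfolding v_def by (auto intro!: derivative_eq_intros)
    then have "deriv (\<lambda>r. u x0 r) s - c * ?w \<le> 0"
      by (rule deriv_nonpos_at_left_min[OF _ s']) (use vmin x0 s in auto)
    \<comment> \<open>Minimality in time thus gives a time derivative of at most \<open>c\<close>,
      whereas \<open>super\<close> together with \<open>lap\<close> makes it larger than
      \<open>c\<close>.\<close>
    moreover have "c * ?w \<le> c"
      using \<open>c > 0\<close> by (simp add: mult_le_cancel_left1)
    moreover have "deriv (\<lambda>r. u x0 r) s >
        laplacian (\<lambda>y. u y s) x0 + c + 2 * k * real CARD('n)"
      using super[of x0 s] x0' s by (simp add: k_def algebra_simps)
    ultimately have False using lap by linarith
    then show ?thesis ..
  qed
  also have "v (x0, s) \<le> v (x, t)"
    using vmin assms by auto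
  finally show ?thesis by (simp add: v_def)
qed

theorem lemma0p7:
  fixes \<Omega> :: "(real^'n::finite) set"
    and u\<^sub>0 :: "real^'n \<Rightarrow> real"
    and u :: "real^'n \<Rightarrow> real \<Rightarrow> real"
    and lam chi T R a \<delta>\<^sub>1 :: real
  assumes "lam > 0" and "chi > 0" and "T > 0"
    and "bounded_C2_domain \<Omega>"
    and "R > 0" and "ball 0 R \<subseteq> \<Omega>"
    and "0 < a" and "a < 1"
    and "set_integrable lebesgue \<Omega> u\<^sub>0"
    and "AE x in lebesgue. x \<in> \<Omega> \<longrightarrow> 0 \<le> u\<^sub>0 x \<and> u\<^sub>0 x \<le> a"
    and "is_solution lam chi \<Omega> T u\<^sub>0 u"
    and "\<And>x t. x \<in> \<Omega> \<Longrightarrow> 0 < t \<Longrightarrow> t < T \<Longrightarrow> 0 \<le> u x t \<and> u x t < 1"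
    and "(SUP t\<in>{0..<T}. \<integral>\<^sup>+ z\<in>\<Omega>. ennreal (1 / (1 - u z t)) \<partial>lebesgue) < \<infinity>"
    and "0 < \<delta>\<^sub>1" and "\<delta>\<^sub>1 \<le> (INF t\<in>{0..<T}. nonlocal_A chi \<Omega> u t)"
    and "lam > 2 * real CARD('n) / (\<delta>\<^sub>1 * R\<^sup>2)"
  shows "T \<le> 1 / (lam * \<delta>\<^sub>1) * inverse (1 - 2 * real CARD('n) / (lam * \<delta>\<^sub>1 * R\<^sup>2))"
proof (rule ccontr)
  let ?n = "real CARD('n)"
  \<comment> \<open>The claimed bound on \<open>T\<close> is exactly \<open>1 / c0\<close>.\<close>
  define c0 where "c0 = lam * \<delta>\<^sub>1 - 2 * ?n / R\<^sup>2"
  have pos: "lam * \<delta>\<^sub>1 > 0" using assms by simp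
  have "c0 > 0"
    using assms(16) \<open>0 < \<delta>\<^sub>1\<close> \<open>R > 0\<close> by (simp add: c0_def pos_divide_less_eq mult_ac)
  have "lam * \<delta>\<^sub>1 * (1 - 2 * ?n / (lam * \<delta>\<^sub>1 * R\<^sup>2)) = c0"
    using \<open>lam > 0\<close> \<open>0 < \<delta>\<^sub>1\<close> \<open>R > 0\<close> by (simp add: c0_def field_simps)
  then have bound: "1 / (lam * \<delta>\<^sub>1) * inverse (1 - 2 * ?n / (lam * \<delta>\<^sub>1 * R\<^sup>2)) = 1 / c0"
    by (metis inverse_eq_divide inverse_mult_distrib)
  assume "\<not> T \<le> 1 / (lam * \<delta>\<^sub>1) * inverse (1 - 2 * ?n / (lam * \<delta>\<^sub>1 * R\<^sup>2))"
  then have T: "1 / c0 < T" unfolding bound by simp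
  \<comment> \<open>The gap below \<open>T\<close> leaves room for a start after time 0, where only
    \<open>L\<^sup>1\<close> convergence is known, and an end before \<open>T\<close>; the gap above
    \<open>1 / c0\<close> gives the strict \<open>c < c0\<close>.\<close>
  then obtain \<tau> where \<tau>: "1 / c0 < \<tau>" "\<tau> < T" using dense by blast
  define c where "c = 1 / \<tau>"
  have "\<tau> > 0" using \<tau> \<open>c0 > 0\<close> by (meson less_trans zero_less_divide_1_iff)
  then have "c > 0" and "c < c0"
    using \<tau>(1) \<open>c0 > 0\<close> by (auto simp: c_def field_simps)
  define t0 where "t0 = (T - \<tau>) / 2"
  define t1 where "t1 = t0 + \<tau>"
  have t: "0 < t0" "t0 \<le> t1" "t1 < T"
    using \<tau> \<open>\<tau> > 0\<close> by (auto simp: t0_def t1_def field_simps)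
  have sub: "{t0..t1} \<subseteq> {0<..<T}" using t by auto
  have cl: "cball 0 R \<subseteq> closure \<Omega>"
    using closure_mono[OF assms(6)] \<open>R > 0\<close> by simp
  note sol = assms(11)[unfolded is_solution_def]
  note C21 = sol[THEN conjunct1, unfolded C21_on_def]
  have cont: "continuous_on (closure \<Omega> \<times> {0<..<T}) (\<lambda>(x, t). u x t)"
    using sol by blast
  \<comment> \<open>The closure matters because the sphere of radius \<open>R\<close> may touch the
    boundary of \<Omega>.\<close>
  have nonneg: "u x t \<ge> 0" if "x \<in> closure \<Omega>" "t \<in> {0<..<T}" for x t
  proof (cases "x \<in> \<Omega>")
    case True
    then show ?thesis using assms(12)[of x t] that by simp
  next
    case False
    have "x \<in> frontier \<Omega>"
      using that False interior_subset[of \<Omega>] by (auto simp: frontier_def)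
    then have "u x t = 0" using sol that by blast
    then show ?thesis by simp
  qed
  have A: "\<delta>\<^sub>1 \<le> nonlocal_A chi \<Omega> u t" if "t \<in> {0<..<T}" for t
  proof -
    have "bdd_below ((\<lambda>t. nonlocal_A chi \<Omega> u t) ` {0..<T})"
      by (rule bdd_belowI2[of _ 0]) (simp add: nonlocal_A_def)
    then have "(INF t\<in>{0..<T}. nonlocal_A chi \<Omega> u t) \<le> nonlocal_A chi \<Omega> u t"
      by (rule cINF_lower) (use that in auto)
    then show ?thesis using assms(15) by linarith
  qed
  have super: "deriv (\<lambda>s. u x s) t > laplacian (\<lambda>y. u y t) x + c + 2 * ?n * c * (t - t0) / R\<^sup>2"
    if x: "x \<in> ball 0 R" and t: "t \<in> {t0..t1}" for x t
  proof -
    have x\<Omega>: "x \<in> \<Omega>" and tT: "t \<in> {0<..<T}"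
      using x t assms(6) sub by auto
    have u: "0 \<le> u x t" "u x t < 1"
      using assms(12)[OF x\<Omega>] tT by auto
    \<comment> \<open>Dividing by a factor in \<open>(0, 1]\<close> can only increase the reaction
      term, which is therefore at least \<open>lam * \<delta>\<^sub>1\<close>.\<close>
    then have "(1 - u x t)\<^sup>2 \<le> 1" "(1 - u x t)\<^sup>2 > 0"
      by (auto simp: power_le_one)
    moreover have "lam * \<delta>\<^sub>1 \<le> lam * nonlocal_A chi \<Omega> u t"
      using A[OF tT] \<open>lam > 0\<close> by simp
    moreover have "lam * nonlocal_A chi \<Omega> u t \<ge> 0"
      using calculation pos by linarith
    ultimately have "lam * \<delta>\<^sub>1 \<le> lam * nonlocal_A chi \<Omega> u t / (1 - u x t)\<^sup>2"
      by (smt (verit) div_by_1 frac_le)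
    also have "\<dots> = deriv (\<lambda>s. u x s) t - laplacian (\<lambda>y. u y t) x"
      using sol x\<Omega> tT by (simp add: nonlocal_A_def mult.commute)
    finally have "lam * \<delta>\<^sub>1 \<le> deriv (\<lambda>s. u x s) t - laplacian (\<lambda>y. u y t) x" .
    \<comment> \<open>The time interval has length \<open>\<tau> = 1 / c\<close>, so the Laplacian
      of the barrier costs at most \<open>2 * ?n / R\<^sup>2\<close>, which is what
      \<open>c0\<close> leaves room for.\<close>
    moreover have "c * (t - t0) \<le> 1"
      using t \<open>\<tau> > 0\<close> by (simp add: c_def t1_def field_simps)
    then have "2 * ?n / R\<^sup>2 * (c * (t - t0)) \<le> 2 * ?n / R\<^sup>2 * 1"
      by (intro mult_left_mono) auto
    then have "2 * ?n * c * (t - t0) / R\<^sup>2 \<le> 2 * ?n / R\<^sup>2"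
      by (simp add: algebra_simps)
    ultimately show ?thesis
      using \<open>c < c0\<close> unfolding c0_def by linarith
  qed
  \<comment> \<open>At the centre of the ball and the final time the barrier reaches 1, which
    contradicts \<open>u < 1\<close>.\<close>
  have "u 0 t1 \<ge> c * (t1 - t0) * (1 - (norm (0::real^'n))\<^sup>2 / R\<^sup>2)"
  proof (rule supersolution_ge_paraboloid[OF \<open>R > 0\<close> \<open>c > 0\<close> t(2) _ _ _ _ _ super])
    show "continuous_on (cball 0 R \<times> {t0..t1}) (\<lambda>(x, t). u x t)"
      by (rule continuous_on_subset[OF cont]) (use cl sub in auto)
  qed (use nonneg cl C21 sub assms(6) \<open>R > 0\<close> t in \<open>auto simp: subset_iff\<close>)
  also have "c * (t1 - t0) * (1 - (norm (0::real^'n))\<^sup>2 / R\<^sup>2) = 1"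
    using \<open>\<tau> > 0\<close> by (simp add: c_def t1_def)
  finally show False
    using assms(12)[of 0 t1] subsetD[OF assms(6), of 0] \<open>R > 0\<close> t by auto
qed

end
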